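(* Let $\epsilon>1$, $0<x<1$ with $\epsilon x\ne1$, let $a,c$ be finite constants, and set $\alpha=1/x$. Then the coefficients $d_{2k}$ (defined in the context) are given by $$d_{2k}=\frac{f(\epsilon)\,C_{2k}}{\kappa(\alpha-\epsilon)}\mp\frac{(-1)^kf(\alpha)}{p^{2k+1}}\qquad(k=0,1,2,\ldots),$$ where the upper sign is chosen when $\epsilon x<1$ and the lower sign when $\epsilon x>1$, and $$C_{2k}=\frac{1}{\hat\alpha_0^{k}}\sum_{s=0}^{2k}\frac{\hat\beta_{2k-s}}{\hat\beta_0}\sum_{j=0}^{s}\frac{(-1)^j(k+\frac12)_j}{j!\,\hat\alpha_0^{j}}\,\mathcal{B}_{sj}.$$
   Context: Notation: $$\psi(t)=(\epsilon-1)\log(t-1)-\epsilon\log t,\qquad f(t)=t^{a-1}(t-1)^{c-a-1},$$ with logarithms and powers real/principal for $t>1$ (branch cut along $(-\infty,1]$). One has $\psi'(\epsilon)=0$ and $\psi''(\epsilon)=-\epsilon^{-1}(\epsilon-1)^{-1}<0$. Set $$p=(\psi(\epsilon)-\psi(\alpha))^{1/2}>0,\qquad\kappa=\left(\tfrac12|\psi''(\epsilon)|\right)^{1/2}>0,$$ and $u_\alpha=-ip$ if $\alpha>\epsilon$, $u_\alpha=+ip$ if $\alpha<\epsilon$. $(y)_j=\Gamma(y+j)/\Gamma(y)$ is the Pochhammer symbol. Definition of $d_{2k}$: let $t=t(u)$ be the function analytic near $u=0$ determined by $u^2=\psi(t)-\psi(\epsilon)$, $t(0)=\epsilon$, $t'(0)=i/\kappa$.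 Then $$d_{2k}=\frac{i}{(2k)!}\left(\frac{d}{du}\right)^{2k}\left\{\frac{f(t(u))\,t'(u)}{t(u)-\alpha}-\frac{f(\alpha)}{u-u_\alpha}\right\}\Bigg|_{u=0}.$$ (These are the coefficients in the large-$\lambda$ uniform expansion of ${}_2F_1(a+\epsilon\lambda,1;c+\lambda;x)$.) The numbers $\hat\alpha_r,\hat\beta_r$ are the coefficients of the expansions near $t=\epsilon$ $$\psi(t)-\psi(\epsilon)=\sum_{r=0}^\infty\hat\alpha_r(t-\epsilon)^{r+2},\qquad\frac{f(t)}{t-\alpha}=\sum_{r=0}^\infty\hat\beta_r(t-\epsilon)^r,$$ and $\mathcal{B}_{sj}=\mathcal{B}_{sj}(\hat\alpha_1,\ldots,\hat\alpha_{s-j+1})$ are the partial ordinary Bell polynomials generated by $$\mathcal{B}_{sj}=\sum_{r=1}^{s-j+1}\hat\alpha_r\,\mathcal{B}_{s-r,j-1},\qquad\mathcal{B}_{s0}=\delta_{s0}.$$ *)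

theory Defs
  imports "HOL-Complex_Analysis.Complex_Analysis"
begin

text \<open>
  The phase is needed both as a real function (for \<open>p\<close> and \<open>\<kappa>\<close>) and as its analytic
  continuation to the complex plane cut along \<open>(-\<infinity>, 1]\<close>; the class \<open>ln\<close> provides the real
  logarithm and the principal complex logarithm at once, and lemma \<open>psi_of_real\<close> shows that
  the two instances agree on \<open>(1, \<infinity>)\<close>.
\<close>

definition psi :: "real \<Rightarrow> 'a \<Rightarrow> 'a::ln" where
  "psi eps t = (of_real eps - 1) * ln (t - 1) - of_real eps * ln t"

lemma psi_of_real:
  assumes "t > (1::real)"
  shows "psi eps (complex_of_real t) = complex_of_real (psi eps t)"
proof -
  have "ln (complex_of_real t - 1) = complex_of_real (ln (t - 1))"
    using assms Ln_of_real[of "t - 1"] by simp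
  moreover have "ln (complex_of_real t) = complex_of_real (ln t)"
    using assms by (simp add: Ln_of_real)
  ultimately show ?thesis
    by (simp add: psi_def)
qed

definition f_amp :: "complex \<Rightarrow> complex \<Rightarrow> complex \<Rightarrow> complex" where
  "f_amp a c t = t powr (a - 1) * (t - 1) powr (c - a - 1)"

definition p_root :: "real \<Rightarrow> real \<Rightarrow> real" where
  "p_root eps \<alpha> = sqrt (psi eps eps - psi eps \<alpha>)"

definition kappa :: "real \<Rightarrow> real" where
  "kappa eps = sqrt (1 / 2 * \<bar>(deriv ^^ 2) (psi eps) eps\<bar>)"

definition u_pole :: "real \<Rightarrow> real \<Rightarrow> complex" where
  "u_pole eps \<alpha> = (if \<alpha> > eps then - \<i> * of_real (p_root eps \<alpha>) else \<i> * of_real (p_root eps \<alpha>))"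

definition is_saddle_map :: "real \<Rightarrow> (complex \<Rightarrow> complex) \<Rightarrow> bool" where
  "is_saddle_map eps t \<longleftrightarrow>
     t analytic_on {0} \<and>
     (\<forall>\<^sub>F u in nhds 0. u\<^sup>2 = psi eps (t u) - psi eps (of_real eps)) \<and>
     t 0 = of_real eps \<and>
     deriv t 0 = \<i> / of_real (kappa eps)"

text \<open>
  The conditions determine \<open>t\<close> only as a germ at \<open>0\<close>. Below only derivatives at \<open>0\<close> of
  expressions in \<open>t\<close> occur, so the choice of a representative is immaterial.
\<close>

definition saddle_map :: "real \<Rightarrow> complex \<Rightarrow> complex" where
  "saddle_map eps = (SOME t. is_saddle_map eps t)"

definition d_even :: "complex \<Rightarrow> complex \<Rightarrow> real \<Rightarrow> real \<Rightarrow> nat \<Rightarrow> complex"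
  \<comment> \<open>\<open>d_even a c eps \<alpha> k\<close> is \<open>d\<^sub>2\<^sub>k\<close>\<close> where
  "d_even a c eps \<alpha> k =
     \<i> / fact (2 * k) *
     (deriv ^^ (2 * k))
       (\<lambda>u. f_amp a c (saddle_map eps u) * deriv (saddle_map eps) u / (saddle_map eps u - of_real \<alpha>)
            - f_amp a c (of_real \<alpha>) / (u - u_pole eps \<alpha>)) 0"

definition alpha_hat :: "real \<Rightarrow> nat \<Rightarrow> complex" where
  "alpha_hat eps r =
     fps_nth (fps_expansion (\<lambda>t. psi eps t - psi eps (of_real eps)) (of_real eps)) (r + 2)"

definition beta_hat :: "complex \<Rightarrow> complex \<Rightarrow> real \<Rightarrow> real \<Rightarrow> nat \<Rightarrow> complex" where
  "beta_hat a c eps \<alpha> r =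
     fps_nth (fps_expansion (\<lambda>t. f_amp a c t / (t - of_real \<alpha>)) (of_real eps)) r"

text \<open>
  Partial ordinary Bell polynomials: \<open>bell_ord b s j\<close> is \<open>\<B>\<^sub>s\<^sub>j(b\<^sub>1, b\<^sub>2, \<dots>)\<close>. The value \<open>b 0\<close> is
  not used. The upper summation limit \<open>s - j\<close> is \<open>s - (j + 1) + 1\<close>; when \<open>s < j + 1\<close>, natural
  subtraction makes the sum empty, as intended.
\<close>

fun bell_ord :: "(nat \<Rightarrow> 'a::comm_ring_1) \<Rightarrow> nat \<Rightarrow> nat \<Rightarrow> 'a" where
  "bell_ord b s 0 = (if s = 0 then 1 else 0)"
| "bell_ord b s (Suc j) = (\<Sum>r=1..s - j. b r * bell_ord b (s - r) j)"

definition C_even :: "complex \<Rightarrow> complex \<Rightarrow> real \<Rightarrow> real \<Rightarrow> nat \<Rightarrow> complex"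
  \<comment> \<open>\<open>C_even a c eps \<alpha> k\<close> is \<open>C\<^sub>2\<^sub>k\<close>\<close> where
  "C_even a c eps \<alpha> k =
     1 / alpha_hat eps 0 ^ k *
     (\<Sum>s=0..2 * k. beta_hat a c eps \<alpha> (2 * k - s) / beta_hat a c eps \<alpha> 0 *
        (\<Sum>j=0..s. (-1) ^ j * pochhammer (of_nat k + 1 / 2) j / (fact j * alpha_hat eps 0 ^ j) *
           bell_ord (alpha_hat eps) s j))"

end

(*
  Write G for the expansion of f(t)/(t - alpha) and T for that of t(u) - eps. Then d_2k splits into a
  geometric series from the subtracted pole and [u^2k] G(T(u)) T'(u), which is the residue of
  G(T) T' / u^(2k+1). Change the variable back to t: there u = -i kappa (t - eps) (1 + B)^(1/2) with
  B the sum of (hat alpha_r / hat alpha_0) (t - eps)^r over r > 0, so the residue is the coefficient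
  of (t - eps)^2k in (-i kappa)^-(2k+1) G (1 + B)^-(k+1/2), and the binomial series gives C_2k.
*)
theory Submission
  imports Defs
begin

unbundle no vec_syntax
unbundle fps_syntax

section \<open>Residues of formal power series under a change of variable\<close>

text \<open>With \<open>T = fps_X * S\<close>, this coefficient is the residue of T' / T^(m+1). For
  m > 0 that quotient is the derivative of -T^(-m)/m and has no residue; for m = 0 the residue
  counts the simple zero of T. Splitting off \<open>fps_X\<close> avoids Laurent series.\<close>

lemma fps_nth_deriv_mult_inverse_power:
  fixes S :: "'a::field_char_0 fps"
  assumes "S $ 0 \<noteq> 0"
  shows "(fps_deriv (fps_X * S) * inverse S ^ Suc m) $ m = (if m = 0 then 1 else 0)"
proof (cases m)
  case 0
  with assms show ?thesis by simp
next
  case (Suc l)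
  define R where "R = inverse S"
  have SR: "S * R = 1"
    using assms by (simp add: R_def inverse_mult_eq_1')
  have "fps_deriv R = - fps_deriv S * R\<^sup>2"
    unfolding R_def using assms by (rule fps_inverse_deriv)
  moreover have "fps_deriv (R ^ m) = of_nat m * fps_deriv R * R ^ l"
    by (subst fps_deriv_power) (simp add: Suc fps_of_nat del: of_nat_Suc)
  ultimately have deriv: "fps_deriv (R ^ m) = fps_const (- of_nat m) * (fps_deriv S * R ^ Suc m)"
    by (simp add: Suc power2_eq_square ac_simps del: of_nat_Suc flip: fps_of_nat fps_const_neg)
  have "fps_deriv (fps_X * S) * R ^ Suc m = (S * R) * R ^ m + fps_X * (fps_deriv S * R ^ Suc m)"
    by (simp add: algebra_simps)
  then have "(fps_deriv (fps_X * S) * R ^ Suc m) $ m = R ^ m $ m + (fps_deriv S * R ^ Suc m) $ l"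
    unfolding SR by (simp add: Suc)
  \<comment> \<open>The factor m makes both summands multiples of the same coefficient of
    \<open>R ^ m\<close>, because l = m - 1. Characteristic 0 allows m to be cancelled at the
    end.\<close>
  also have "of_nat m * \<dots> = of_nat m * R ^ m $ m - fps_deriv (R ^ m) $ l"
    unfolding deriv fps_mult_left_const_nth by (simp add: algebra_simps)
  also have "\<dots> = 0"
    unfolding fps_deriv_nth by (simp add: Suc del: power_Suc of_nat_Suc)
  finally have "of_nat m * (fps_deriv (fps_X * S) * R ^ Suc m) $ m = 0" .
  moreover have "of_nat m \<noteq> (0 :: 'a)"
    by (simp add: Suc del: of_nat_Suc)
  ultimately show ?thesis
    unfolding R_def mult_eq_0_iff by (simp add: Suc del: of_nat_Suc power_Suc)
qed

text \<open>Invariance of the residue of \<open>H(t) / t\<^sup>n\<^sup>+\<^sup>1\<close> under the substitution \<open>t = u S(u)\<close>.\<close>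

lemma fps_nth_compose_mult_deriv:
  fixes H S :: "'a::field_char_0 fps"
  assumes "S $ 0 \<noteq> 0"
  shows "((H oo (fps_X * S)) * fps_deriv (fps_X * S) * inverse S ^ Suc n) $ n = H $ n"
proof -
  define T where "T = fps_X * S"
  define K where "K = fps_deriv T * inverse S ^ Suc n"
  \<comment> \<open>T^i uses up i of the n + 1 inverse factors of S and shifts the index by i, which
    leaves the preceding lemma with m = n - i.\<close>
  have TK: "(T ^ i * K) $ n = (if i = n then 1 else 0)" if "i \<le> n" for i
  proof -
    have "S * inverse S = 1"
      using assms by (simp add: inverse_mult_eq_1')
    then have "S ^ i * inverse S ^ i = 1"
      by (metis power_mult_distrib power_one)
    moreover have "Suc n = i + Suc (n - i)"
      using that by simp
    ultimately have "S ^ i * inverse S ^ Suc n = inverse S ^ Suc (n - i)"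
      by (metis mult.assoc mult_1 power_add)
    then have "T ^ i * K = fps_X ^ i * (fps_deriv T * inverse S ^ Suc (n - i))"
      by (simp add: T_def K_def power_mult_distrib ac_simps del: power_Suc)
    then have "(T ^ i * K) $ n = (fps_deriv T * inverse S ^ Suc (n - i)) $ (n - i)"
      using that by (simp add: fps_X_power_mult_nth)
    also have "\<dots> = (if i = n then 1 else 0)"
      using fps_nth_deriv_mult_inverse_power[OF assms, of "n - i"] that by (auto simp: T_def)
    finally show ?thesis .
  qed
  have "((H oo T) * K) $ n = (\<Sum>j\<le>n. (H oo T) $ j * K $ (n - j))"
    by (simp add: fps_mult_nth atLeast0AtMost)
  also have "\<dots> = (\<Sum>j\<le>n. (\<Sum>i\<le>n. H $ i * T ^ i $ j) * K $ (n - j))"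
  proof (intro sum.cong refl arg_cong2[where f = "(*)"])
    fix j assume "j \<in> {..n}"
    \<comment> \<open>T^i starts at degree i, so the inner range can be extended to a bound
      independent of j; the two sums can then be interchanged.\<close>
    then have "(\<Sum>i\<le>j. H $ i * T ^ i $ j) = (\<Sum>i\<le>n. H $ i * T ^ i $ j)"
      by (intro sum.mono_neutral_left)
         (auto simp: T_def power_mult_distrib fps_X_power_mult_nth)
    then show "(H oo T) $ j = (\<Sum>i\<le>n. H $ i * T ^ i $ j)"
      by (simp add: fps_compose_nth atLeast0AtMost)
  qed
  also have "\<dots> = (\<Sum>i\<le>n. H $ i * (T ^ i * K) $ n)"
    by (subst sum_distrib_right, subst sum.swap)
       (simp add: sum_distrib_left fps_mult_nth atLeast0AtMost mult.assoc)
  also have "\<dots> = (\<Sum>i\<le>n. if i = n then H $ i else 0)"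
    by (intro sum.cong) (auto simp: TK)
  finally show ?thesis
    by (simp add: T_def K_def mult.assoc)
qed

section \<open>Bell polynomials and half-integer powers of series\<close>

text \<open>The recursion is the Cauchy product with one more factor. The zero constant term removes
  r = 0, and the order of the j-th power removes r > s - j.\<close>

lemma bell_ord_conv_fps_power:
  fixes b :: "nat \<Rightarrow> 'a::comm_ring_1"
  shows "bell_ord b s j = (Abs_fps (\<lambda>r. if r = 0 then 0 else b r) ^ j) $ s"
proof (induction j arbitrary: s)
  case (Suc j)
  let ?B = "Abs_fps (\<lambda>r. if r = 0 then 0 else b r)"
  have vanish: "(?B ^ j) $ i = 0" if "i < j" for i
    using that by (intro startsby_zero_power_prefix[THEN spec[where x = i], THEN mp]) auto
  have "(?B ^ Suc j) $ s = (\<Sum>r=0..s. ?B $ r * (?B ^ j) $ (s - r))"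
    by (simp add: fps_mult_nth)
  also have "\<dots> = (\<Sum>r=1..s - j. ?B $ r * (?B ^ j) $ (s - r))"
    by (rule sum.mono_neutral_right) (auto simp: vanish)
  also have "\<dots> = bell_ord b s (Suc j)"
    by (simp add: Suc)
  finally show ?case ..
qed simp

text \<open>\<open>F\<close> factors as w^2 X^2 (1 + B), and the binomial series supplies the square
  root of 1 + B. The choice of w fixes the branch.\<close>

lemma fps_binomial_half_square:
  fixes F :: "'a::field_char_0 fps"
  defines "B \<equiv> Abs_fps (\<lambda>r. if r = 0 then 0 else F $ (r + 2) / F $ 2)"
  assumes F: "F $ 0 = 0" "F $ 1 = 0" "F $ 2 = w\<^sup>2" and w: "w \<noteq> 0"
  shows "(fps_const w * (fps_X * (fps_binomial (1 / 2) oo B)))\<^sup>2 = F"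
proof -
  have B0: "B $ 0 = 0"
    by (simp add: B_def)
  have "(fps_binomial (1 / 2) oo B)\<^sup>2 = 1 + B"
    by (simp add: fps_compose_power[OF B0] fps_binomial_power fps_binomial_1
        fps_compose_add_distrib B0 fps_X_fps_compose_startby0)
  moreover have "F = fps_const (w\<^sup>2) * (fps_X\<^sup>2 * (1 + B))"
  proof (rule fps_ext)
    fix n :: nat
    consider "n = 0" | "n = 1" | r where "n = r + 2"
      by atomize_elim presburger
    then show "F $ n = (fps_const (w\<^sup>2) * (fps_X\<^sup>2 * (1 + B))) $ n"
      by cases (use F w in \<open>auto simp: fps_X_power_mult_nth B_def simp flip: numeral_2_eq_2\<close>)
  qed
  ultimately show ?thesis
    by (simp add: power_mult_distrib flip: fps_const_power)
qed

text \<open>The equation for \<open>F oo T\<close> makes \<open>T\<close> the compositional inverse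
  of the square root \<open>V\<close> of \<open>F\<close>. The powers of \<open>inverse S\<close> in
  the residue lemma thus become half-integer powers of 1 + B composed with \<open>T\<close>.\<close>

lemma fps_nth_compose_mult_deriv_of_square:
  fixes F G T :: "'a::field_char_0 fps"
  assumes F: "F $ 0 = 0" "F $ 1 = 0" "F $ 2 = w\<^sup>2" and w: "w \<noteq> 0"
    and T: "T $ 0 = 0" "T $ 1 = 1 / w" and FT: "F oo T = fps_X\<^sup>2"
  shows "((G oo T) * fps_deriv T) $ (2 * k) =
    (\<Sum>s=0..2 * k. G $ (2 * k - s) *
       (\<Sum>j=0..s. (-1) ^ j * pochhammer (of_nat k + 1 / 2) j / (fact j * (F $ 2) ^ j) *
         bell_ord (\<lambda>r. F $ (r + 2)) s j)) / w ^ (2 * k + 1)"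
proof -
  define B where "B = Abs_fps (\<lambda>r. if r = 0 then 0 else F $ (r + 2) / F $ 2)"
  define P where "P c = fps_binomial c oo B" for c
  have B0: "B $ 0 = 0"
    by (simp add: B_def)
  have P_add: "P (c + d) = P c * P d" for c d
    by (simp add: P_def fps_binomial_add_mult fps_compose_mult_distrib[OF B0])
  have P_power: "P c ^ n = P (of_nat n * c)" for c n
    by (simp add: P_def fps_compose_power[OF B0] fps_binomial_power)
  have P_0: "P 0 = 1"
    by (simp add: P_def)
  define V where "V = fps_const w * (fps_X * P (1 / 2))"
  have "V\<^sup>2 = F"
    unfolding V_def P_def B_def by (rule fps_binomial_half_square) (use F w in auto)
  then have "(V oo T)\<^sup>2 = fps_X\<^sup>2"
    by (simp add: fps_compose_power[OF T(1)] FT)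
  \<comment> \<open>The square leaves only X and -X for \<open>V oo T\<close>; the linear
    coefficient w * (1/w) decides.\<close>
  moreover have VT1: "(V oo T) $ 1 = 1"
    using w T by (simp add: fps_compose_nth V_def mult.assoc P_def)
  moreover have "V oo T \<noteq> - fps_X"
  proof
    assume "V oo T = - fps_X"
    then have "(V oo T) $ 1 = (- fps_X) $ 1"
      by (rule arg_cong)
    with VT1 show False
      by simp
  qed
  ultimately have VT: "V oo T = fps_X"
    by (simp add: power2_eq_iff)
  define S where "S = fps_shift 1 T"
  have T_eq: "T = fps_X * S"
    using T by (simp add: S_def fps_eq_iff)
  have S0: "S $ 0 \<noteq> 0"
    using T w by (simp add: S_def)
  \<comment> \<open>\<open>V oo T = fps_X\<close> written out, with one factor X split off from
    \<open>T\<close>; cancelling it exhibits the inverse of \<open>S\<close>.\<close>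
  have "fps_X * (fps_const w * S * (P (1 / 2) oo T)) = fps_X * 1"
    using VT T(1) T_eq
    by (simp add: V_def fps_compose_mult_distrib mult_ac)
  then have "S * (fps_const w * (P (1 / 2) oo T)) = 1"
    by (simp add: mult_ac)
  then have inverse_S: "inverse S = fps_const w * (P (1 / 2) oo T)"
    by (rule fps_inverse_unique)
  define n where "n = 2 * k + 1"
  \<comment> \<open>e = -n/2, so that \<open>P e\<close> cancels the n half powers coming from
    \<open>inverse S ^ n\<close>.\<close>
  define e where "e = - (of_nat k + 1 / 2 :: 'a)"
  have P_e: "P e $ s = (\<Sum>j=0..s. (-1) ^ j * pochhammer (of_nat k + 1 / 2) j / (fact j * (F $ 2) ^ j) *
         bell_ord (\<lambda>r. F $ (r + 2)) s j)" for s
  proof -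
    have "B = fps_const (1 / F $ 2) * Abs_fps (\<lambda>r. if r = 0 then 0 else F $ (r + 2))"
      by (simp add: fps_eq_iff B_def)
    then have "B ^ j $ s = bell_ord (\<lambda>r. F $ (r + 2)) s j / (F $ 2) ^ j" for j
      by (simp add: power_mult_distrib bell_ord_conv_fps_power power_one_over del: add_2_eq_Suc')
    then show ?thesis
      by (simp add: P_def fps_compose_nth gbinomial_pochhammer e_def add.commute)
  qed
  \<comment> \<open>Chosen so that \<open>H oo T\<close> times \<open>inverse S ^ n\<close> is
    \<open>G oo T\<close>; the residue lemma then reads off a coefficient of
    \<open>H\<close>.\<close>
  define H where "H = fps_const (1 / w ^ n) * (P e * G)"
  have "inverse S ^ n = fps_const (w ^ n) * (P (of_nat n / 2) oo T)"
    by (simp add: inverse_S power_mult_distrib fps_compose_power[OF T(1)] P_power)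
  moreover have "P e * P (of_nat n / 2) = 1"
    by (simp add: P_0 n_def e_def field_simps flip: P_add)
  then have "(P e oo T) * (P (of_nat n / 2) oo T) = 1"
    by (simp flip: fps_compose_mult_distrib[OF T(1)])
  moreover have "fps_const (1 / w ^ n) * fps_const (w ^ n) = (1 :: 'a fps)"
    using w by simp
  moreover have "H oo T = fps_const (1 / w ^ n) * ((G oo T) * (P e oo T))"
    by (simp add: H_def mult.commute[of _ G] fps_compose_mult_distrib[OF T(1)])
  ultimately have "(H oo T) * inverse S ^ n = G oo T"
    by (smt (verit) mult.assoc mult.commute mult_1)
  then have "((G oo T) * fps_deriv T) $ (2 * k) = ((H oo T) * fps_deriv T * inverse S ^ Suc (2 * k)) $ (2 * k)"
    by (simp add: n_def mult_ac del: power_Suc)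
  also have "\<dots> = H $ (2 * k)"
    unfolding T_eq by (rule fps_nth_compose_mult_deriv[OF S0])
  also have "\<dots> = (\<Sum>s=0..2 * k. G $ (2 * k - s) * P e $ s) / w ^ n"
    unfolding H_def fps_mult_left_const_nth fps_mult_nth[of "P e" G] by (simp add: mult_ac)
  finally show ?thesis
    by (simp only: n_def P_e)
qed

section \<open>Analytic germs at 0: local inverse and square root\<close>

lemma has_fps_expansion_imp_eventually_eq:
  assumes "f has_fps_expansion F" "g has_fps_expansion F"
  shows "eventually (\<lambda>z. f z = g z) (nhds 0)"
  using assms by (auto simp: has_fps_expansion_def elim: eventually_elim2)

lemma analytic_local_right_inverse:
  fixes v :: "complex \<Rightarrow> complex"
  assumes "v analytic_on {0}" "v 0 = 0" "deriv v 0 \<noteq> 0"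
  obtains g where "g analytic_on {0}" "g 0 = 0" "deriv g 0 = 1 / deriv v 0"
    "eventually (\<lambda>u. v (g u) = u) (nhds 0)"
proof -
  obtain A where A: "open A" "0 \<in> A" "v holomorphic_on A"
    using assms(1) by (auto simp: analytic_at)
  obtain r where r: "r > 0" "ball 0 r \<subseteq> A" "open (v ` ball 0 r)" "inj_on v (ball 0 r)"
    using has_complex_derivative_locally_invertible[OF A(3,2,1) assms(3)] by blast
  have hol: "v holomorphic_on ball 0 r"
    using A(3) r(2) by (rule holomorphic_on_subset)
  obtain g where g: "g holomorphic_on v ` ball 0 r"
    "\<And>z. z \<in> ball 0 r \<Longrightarrow> deriv v z * deriv g (v z) = 1" "\<And>z. z \<in> ball 0 r \<Longrightarrow> g (v z) = z"
    using holomorphic_has_inverse[OF hol open_ball r(4)] by blast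
  have 0: "0 \<in> v ` ball 0 r"
    using assms(2) r(1) by force
  show ?thesis
  proof
    show "g analytic_on {0}"
      using g(1) r(3) 0 by (auto simp: analytic_at)
    show "g 0 = 0"
      using g(3)[of 0] r(1) assms(2) by simp
    show "deriv g 0 = 1 / deriv v 0"
      using g(2)[of 0] r(1) assms(2,3) by (simp add: field_simps)
    show "eventually (\<lambda>u. v (g u) = u) (nhds 0)"
      using eventually_nhds_in_open[OF r(3) 0] by eventually_elim (use g(3) in auto)
  qed
qed

text \<open>Analytic counterpart of the formal root: dividing by the leading term w^2 z^2 leaves 1 +
  b with b(0) = 0, where the principal square root is analytic.\<close>

lemma has_fps_expansion_square_root:
  fixes f :: "complex \<Rightarrow> complex"
  assumes f: "f has_fps_expansion F" and F: "F $ 0 = 0" "F $ 1 = 0" "F $ 2 = w\<^sup>2" and w: "w \<noteq> 0"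
  obtains v where "v analytic_on {0}" "v 0 = 0" "deriv v 0 = w" "eventually (\<lambda>z. (v z)\<^sup>2 = f z) (nhds 0)"
proof -
  define B where "B = Abs_fps (\<lambda>r. if r = 0 then 0 else F $ (r + 2) / F $ 2)"
  have B0: "B $ 0 = 0"
    by (simp add: B_def)
  have B_eq: "B = fps_const (1 / F $ 2) * fps_shift 2 F - 1"
    by (rule fps_ext) (use F w in \<open>auto simp: B_def simp flip: numeral_2_eq_2\<close>)
  have sub: "2 \<le> subdegree F"
    using F w by (intro subdegree_geI) (auto simp: less_2_cases_iff)
  \<comment> \<open>The value at 0 fills the removable singularity of f(z)/z^2.\<close>
  define b where "b z = 1 / F $ 2 * (if z = 0 then F $ 2 else f z / z ^ 2) - 1" for z
  have b: "b has_fps_expansion B"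
    unfolding b_def B_eq by (intro fps_expansion_intros f sub refl)
  define v where "v z = w * (z * ((\<lambda>z. (1 + z) powr (1 / 2)) \<circ> b) z)" for z
  define V where "V = fps_const w * (fps_X * (fps_binomial (1 / 2) oo B))"
  have v: "v has_fps_expansion V"
    unfolding v_def V_def by (intro fps_expansion_intros b B0)
  have VF: "V\<^sup>2 = F"
    unfolding V_def B_def by (rule fps_binomial_half_square) (use F w in auto)
  show ?thesis
  proof
    show "v analytic_on {0}"
      using v by (rule has_fps_expansion_imp_analytic_0)
    show "v 0 = 0"
      by (simp add: v_def)
    show "deriv v 0 = w"
      using fps_nth_fps_expansion[OF v, of 1] by (simp add: V_def)
    have "(\<lambda>z. (v z)\<^sup>2) has_fps_expansion F"
      unfolding VF[symmetric] by (intro fps_expansion_intros v)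
    then show "eventually (\<lambda>z. (v z)\<^sup>2 = f z) (nhds 0)"
      using f by (rule has_fps_expansion_imp_eventually_eq)
  qed
qed

section \<open>The phase and its saddle point\<close>

lemma psi_complex_deriv:
  assumes "Re t > 1"
  shows "(psi eps has_field_derivative (of_real eps - t) / (t * (t - 1))) (at t)"
proof -
  have nz: "t \<noteq> 0" "t - 1 \<noteq> 0"
    using assms by auto
  have "(psi eps has_field_derivative ((of_real eps - 1) * (1 / (t - 1)) - of_real eps * (1 / t))) (at t)"
    unfolding psi_def [abs_def] using assms nz
    by (auto intro!: derivative_eq_intros simp: complex_nonpos_Reals_iff divide_inverse mult_ac)
  also have "(of_real eps - 1) * (1 / (t - 1)) - of_real eps * (1 / t) = (of_real eps - t) / (t * (t - 1))"
    using nz by (simp add: divide_simps) (simp add: algebra_simps)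
  finally show ?thesis .
qed

lemma psi_real_deriv:
  assumes "t > (1::real)"
  shows "(psi eps has_field_derivative (eps - t) / (t * (t - 1))) (at t)"
proof -
  have "(psi eps has_field_derivative ((eps - 1) * (1 / (t - 1)) - eps * (1 / t))) (at t)"
    unfolding psi_def [abs_def] using assms
    by (auto intro!: derivative_eq_intros)
  also have "(eps - 1) * (1 / (t - 1)) - eps * (1 / t) = (eps - t) / (t * (t - 1))"
    using assms by (simp add: field_simps)
  finally show ?thesis .
qed

text \<open>The derivative (eps - t)/(t(t - 1)) changes sign from plus to minus at eps. This yields
  \<open>p_root\<close> > 0.\<close>

lemma psi_less_psi_saddle:
  assumes "eps > 1" "t > 1" "t \<noteq> eps"
  shows "psi eps t < psi eps (eps :: real)"
proof (cases "t < eps")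
  case True
  show ?thesis
  proof (rule DERIV_pos_imp_increasing_open[OF True])
    fix y assume "t < y" "y < eps"
    then show "\<exists>d. (psi eps has_real_derivative d) (at y) \<and> d > 0"
      using assms by (intro exI[of _ "(eps - y) / (y * (y - 1))"] conjI psi_real_deriv divide_pos_pos) auto
  next
    show "continuous_on {t..eps} (psi eps)"
      using assms by (intro continuous_at_imp_continuous_on ballI DERIV_isCont[OF psi_real_deriv]) auto
  qed
next
  case False
  with assms have *: "eps < t"
    by simp
  show ?thesis
  proof (rule DERIV_neg_imp_decreasing_open[OF *])
    fix y assume "eps < y" "y < t"
    then show "\<exists>d. (psi eps has_real_derivative d) (at y) \<and> d < 0"
      using assms by (intro exI[of _ "(eps - y) / (y * (y - 1))"] conjI psi_real_deriv divide_neg_pos) auto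
  next
    show "continuous_on {eps..t} (psi eps)"
      using assms by (intro continuous_at_imp_continuous_on ballI DERIV_isCont[OF psi_real_deriv]) auto
  qed
qed

lemma kappa_squared:
  assumes "eps > 1"
  shows "kappa eps > 0" "(kappa eps)\<^sup>2 = 1 / (2 * eps * (eps - 1))"
proof -
  have "eventually (\<lambda>t. t \<in> {1<..}) (nhds eps)"
    by (rule eventually_nhds_in_open) (use assms in auto)
  then have "eventually (\<lambda>t. deriv (psi eps) t = (eps - t) / (t * (t - 1))) (nhds eps)"
    by eventually_elim (auto intro!: DERIV_imp_deriv psi_real_deriv)
  then have "(deriv ^^ 2) (psi eps) eps = deriv (\<lambda>t. (eps - t) / (t * (t - 1))) eps"
    by (simp add: numeral_2_eq_2 deriv_cong_ev)
  also have "\<dots> = - (1 / (eps * (eps - 1)))"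
    by (rule DERIV_imp_deriv) (use assms in \<open>auto intro!: derivative_eq_intros simp: divide_simps\<close>)
  finally have "(deriv ^^ 2) (psi eps) eps = - (1 / (eps * (eps - 1)))" .
  moreover have "eps * (eps - 1) > 0"
    using assms by simp
  ultimately show "kappa eps > 0" "(kappa eps)\<^sup>2 = 1 / (2 * eps * (eps - 1))"
    by (simp_all add: kappa_def)
qed

text \<open>The linear term vanishes at the saddle, and half the second derivative is -kappa^2. Of
  its two roots, -i kappa is the one whose reciprocal is the prescribed t'(0).\<close>

lemma psi_fps_expansion:
  fixes eps :: real
  defines "F \<equiv> fps_expansion (\<lambda>t. psi eps t - psi eps (of_real eps)) (of_real eps :: complex)"
  assumes "eps > 1"
  shows "(\<lambda>h. psi eps (of_real eps + h) - psi eps (of_real eps :: complex)) has_fps_expansion F"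
    and "F $ 0 = 0" "F $ 1 = 0" "F $ 2 = (- \<i> * of_real (kappa eps))\<^sup>2"
proof -
  let ?e = "of_real eps :: complex"
  let ?f = "\<lambda>t. psi eps t - psi eps ?e"
  have "?f analytic_on {?e}"
    unfolding psi_def using assms by (auto intro!: analytic_intros simp: complex_nonpos_Reals_iff)
  then show "(\<lambda>h. psi eps (?e + h) - psi eps ?e) has_fps_expansion F"
    unfolding F_def by (rule analytic_at_imp_has_fps_expansion)
  \<comment> \<open>The formula is needed on a neighbourhood, since it is differentiated once more
    below.\<close>
  have *: "eventually (\<lambda>t. deriv ?f t = (?e - t) / (t * (t - 1))) (nhds ?e)"
  proof -
    have "eventually (\<lambda>t. t \<in> {t. Re t > 1}) (nhds ?e)"
      by (rule eventually_nhds_in_open) (use assms in \<open>auto simp: open_halfspace_Re_gt\<close>)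
    then show ?thesis
    proof eventually_elim
      case (elim t)
      then have "(?f has_field_derivative (?e - t) / (t * (t - 1)) - 0) (at t)"
        by (intro DERIV_diff psi_complex_deriv DERIV_const) auto
      then show ?case
        by (simp add: DERIV_imp_deriv)
    qed
  qed
  show "F $ 0 = 0"
    by (simp add: F_def fps_expansion_def)
  show "F $ 1 = 0"
    using eventually_nhds_x_imp_x[OF *] by (simp add: F_def fps_expansion_def)
  have "(deriv ^^ 2) ?f ?e = deriv (\<lambda>t. (?e - t) / (t * (t - 1))) ?e"
    using * by (simp add: numeral_2_eq_2 deriv_cong_ev)
  also have "\<dots> = - (1 / (?e * (?e - 1)))"
    by (rule DERIV_imp_deriv) (use assms in \<open>auto intro!: derivative_eq_intros simp: divide_simps\<close>)
  finally have "F $ 2 = - of_real (1 / (2 * eps * (eps - 1)))"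
    by (simp add: F_def fps_expansion_def)
  then show "F $ 2 = (- \<i> * of_real (kappa eps))\<^sup>2"
    using kappa_squared[OF assms(2)] by (simp add: power_mult_distrib flip: of_real_power)
qed

text \<open>\<open>SOME\<close> requires existence: for an analytic square root v of the phase
  difference and its local inverse g, the map eps + g(u) satisfies all conditions.\<close>

lemma saddle_map:
  assumes "eps > 1"
  shows "is_saddle_map eps (saddle_map eps)"
proof -
  let ?e = "of_real eps :: complex"
  define w where "w = - \<i> * of_real (kappa eps)"
  have w: "w \<noteq> 0"
    using kappa_squared(1)[OF assms] by (simp add: w_def)
  have inverse_w: "1 / w = \<i> / of_real (kappa eps)"
    using kappa_squared(1)[OF assms] by (simp add: w_def divide_simps)
  obtain v where v: "v analytic_on {0}" "v 0 = 0" "deriv v 0 = w"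
    "eventually (\<lambda>h. (v h)\<^sup>2 = psi eps (?e + h) - psi eps ?e) (nhds 0)"
    using has_fps_expansion_square_root[OF psi_fps_expansion[OF assms, folded w_def] w] by blast
  then obtain g where g: "g analytic_on {0}" "g 0 = 0" "deriv g 0 = 1 / w"
    "eventually (\<lambda>u. v (g u) = u) (nhds 0)"
    using analytic_local_right_inverse[of v] w by metis
  have "isCont g 0"
    using g(1) analytic_at_imp_isCont by blast
  \<comment> \<open>g(u) tends to 0, so the identity for v^2 near 0 may be evaluated at
    g(u).\<close>
  then have "filterlim g (nhds 0) (nhds 0)"
    using g(2) tendsto_at_iff_tendsto_nhds[of g 0] by (simp add: continuous_at)
  then have "eventually (\<lambda>u. (v (g u))\<^sup>2 = psi eps (?e + g u) - psi eps ?e) (nhds 0)"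
    by (rule eventually_compose_filterlim[OF v(4)])
  then have square: "eventually (\<lambda>u. u\<^sup>2 = psi eps (?e + g u) - psi eps ?e) (nhds 0)"
    using g(4) by eventually_elim simp
  have "g field_differentiable at 0"
    using g(1) by (rule analytic_on_imp_differentiable_at) simp
  then have "deriv (\<lambda>u. ?e + g u) 0 = \<i> / of_real (kappa eps)"
    using g(3) by (simp add: inverse_w)
  with g square have "is_saddle_map eps (\<lambda>u. ?e + g u)"
    by (simp add: is_saddle_map_def analytic_intros)
  then show ?thesis
    unfolding saddle_map_def by (rule someI[of "is_saddle_map eps"])
qed

section \<open>The coefficient formula\<close>

lemma fps_inverse_X_minus_const:
  fixes c :: "'a::field"
  assumes "c \<noteq> 0"
  shows "inverse (fps_X - fps_const c) = Abs_fps (\<lambda>n. - 1 / c ^ Suc n)"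
proof (rule fps_inverse_unique)
  show "(fps_X - fps_const c) * Abs_fps (\<lambda>n. - 1 / c ^ Suc n) = 1"
  proof (rule fps_ext)
    fix n
    show "((fps_X - fps_const c) * Abs_fps (\<lambda>n. - 1 / c ^ Suc n)) $ n = 1 $ n"
      using assms by (cases n) (simp_all add: left_diff_distrib)
  qed
qed

theorem mainTheorem3:
  fixes eps x \<alpha> :: real and a c :: complex and k :: nat
  assumes "eps > 1" and "0 < x" and "x < 1" and "eps * x \<noteq> 1" and "\<alpha> = 1 / x"
  shows "d_even a c eps \<alpha> k =
           f_amp a c (of_real eps) * C_even a c eps \<alpha> k / of_real (kappa eps * (\<alpha> - eps))
           + (if eps * x < 1 then - 1 else 1) *
             ((-1) ^ k * f_amp a c (of_real \<alpha>) / of_real (p_root eps \<alpha> ^ (2 * k + 1)))"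
proof -
  let ?e = "of_real eps :: complex" and ?n = "2 * k"
  have \<alpha>: "\<alpha> > 1" "\<alpha> \<noteq> eps" "\<alpha> > eps \<longleftrightarrow> eps * x < 1"
    unfolding assms(5) using assms(1-4) by (auto simp: less_divide_eq divide_eq_eq)
  define p where "p = p_root eps \<alpha>"
  have p: "p > 0"
    using psi_less_psi_saddle[of eps \<alpha>] assms(1) \<alpha> by (simp add: p_def p_root_def)
  define w where "w = - \<i> * of_real (kappa eps)"
  have kappa: "kappa eps > 0"
    using kappa_squared(1)[OF assms(1)] .
  then have w: "w \<noteq> 0"
    by (simp add: w_def)
  have inverse_w: "1 / w = \<i> / of_real (kappa eps)"
    using kappa by (simp add: w_def divide_simps)
  define F where "F = fps_expansion (\<lambda>t. psi eps t - psi eps ?e) ?e"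
  note F = psi_fps_expansion[OF assms(1), folded F_def w_def]
  have alpha_hat: "alpha_hat eps = (\<lambda>r. F $ (r + 2))"
    by (simp add: fun_eq_iff alpha_hat_def F_def)
  define g where "g t = f_amp a c t / (t - of_real \<alpha>)" for t
  define G where "G = fps_expansion g ?e"
  have "g analytic_on {?e}"
    unfolding g_def f_amp_def using assms(1) \<alpha>(2)
    by (auto intro!: analytic_intros simp: complex_nonpos_Reals_iff)
  then have G: "(\<lambda>h. g (?e + h)) has_fps_expansion G"
    unfolding G_def by (rule analytic_at_imp_has_fps_expansion)
  have beta_hat: "beta_hat a c eps \<alpha> r = G $ r" for r
    by (simp add: beta_hat_def G_def g_def [abs_def])
  have G0: "G $ 0 = g ?e" "G $ 0 \<noteq> 0"
    using assms(1) \<alpha>(2) by (simp_all add: G_def fps_expansion_def g_def f_amp_def)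

  define t where "t = saddle_map eps"
  have t: "t analytic_on {0}" "eventually (\<lambda>u. u\<^sup>2 = psi eps (t u) - psi eps ?e) (nhds 0)"
    "t 0 = ?e" "deriv t 0 = \<i> / of_real (kappa eps)"
    using saddle_map[OF assms(1)] by (simp_all add: is_saddle_map_def t_def)
  define T where "T = fps_expansion t 0 - fps_const ?e"
  have t_exp: "t has_fps_expansion fps_expansion t 0"
    using t(1) by (rule analytic_at_imp_has_fps_expansion_0)
  then have T: "(\<lambda>u. t u - ?e) has_fps_expansion T"
    unfolding T_def by (intro fps_expansion_intros)
  have T01: "T $ 0 = 0" "T $ 1 = 1 / w"
    using t(3,4) inverse_w by (simp_all add: T_def fps_expansion_def)
  \<comment> \<open>The defining equation of the saddle map becomes an identity of series by
    uniqueness of expansions.\<close>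
  have "((\<lambda>h. psi eps (?e + h) - psi eps ?e) \<circ> (\<lambda>u. t u - ?e)) has_fps_expansion (F oo T)"
    using F(1) T T01(1) by (rule has_fps_expansion_compose)
  moreover have "eventually (\<lambda>u. ((\<lambda>h. psi eps (?e + h) - psi eps ?e) \<circ> (\<lambda>u. t u - ?e)) u = u\<^sup>2) (nhds 0)"
    using t(2) by eventually_elim simp
  ultimately have "(\<lambda>u. u\<^sup>2) has_fps_expansion (F oo T)"
    by (simp add: has_fps_expansion_cong)
  then have FT: "F oo T = fps_X\<^sup>2"
    using fps_expansion_eqI has_fps_expansion_fps_X_power by metis

  define K where "K = (G oo T) * fps_deriv T"
  have "((\<lambda>h. g (?e + h)) \<circ> (\<lambda>u. t u - ?e)) has_fps_expansion (G oo T)"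
    using G T T01(1) by (rule has_fps_expansion_compose)
  moreover have "deriv t has_fps_expansion fps_deriv T"
    using has_fps_expansion_deriv[OF t_exp] by (simp add: T_def)
  ultimately have K: "(\<lambda>u. g (t u) * deriv t u) has_fps_expansion K"
    unfolding K_def using has_fps_expansion_mult by (fastforce simp: o_def)

  define q where "q = u_pole eps \<alpha>"
  \<comment> \<open>The pole lies away from u = 0, so the subtracted term has a power series
    there.\<close>
  have q: "q \<noteq> 0"
    using p by (simp add: q_def u_pole_def p_def)
  define A where "A = f_amp a c (of_real \<alpha>)"
  have "(\<lambda>u. g (t u) * deriv t u - A * inverse (u - q)) has_fps_expansion
      (K - fps_const A * inverse (fps_X - fps_const q))"
    by (intro fps_expansion_intros K) (simp add: q)
  from fps_nth_fps_expansion[OF this, of ?n]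
  have "d_even a c eps \<alpha> k = \<i> * (K - fps_const A * inverse (fps_X - fps_const q)) $ ?n"
    by (simp add: d_even_def t_def g_def A_def q_def divide_inverse mult_ac)
  also have "\<dots> = \<i> * K $ ?n + \<i> * A / q ^ (?n + 1)"
    unfolding fps_inverse_X_minus_const[OF q] by (simp add: algebra_simps)
  also have "\<i> * A / q ^ (?n + 1) = (if eps * x < 1 then - 1 else 1) * ((-1) ^ k * A / of_real (p ^ (?n + 1)))"
  proof -
    \<comment> \<open>The sign in \<mp>. Since q = \<sigma> i p and \<sigma>^2 = 1, the odd power of
      q is (-1)^k \<sigma> i p^(2k+1), and dividing i by it leaves (-1)^k \<sigma>.\<close>
    define \<sigma> :: complex where "\<sigma> = (if eps * x < 1 then - 1 else 1)"
    have \<sigma>: "\<sigma> * \<sigma> = 1"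
      by (simp add: \<sigma>_def)
    have q_eq: "q = \<sigma> * \<i> * of_real p"
      using \<alpha>(3) by (simp add: q_def u_pole_def p_def \<sigma>_def)
    then have "q\<^sup>2 = - (of_real p)\<^sup>2"
      using \<sigma> by (simp add: power_mult_distrib power2_eq_square[of \<sigma>])
    then have "q ^ (?n + 1) = (- 1) ^ k * (\<sigma> * \<i> * of_real (p ^ (?n + 1)))"
      by (simp add: power_mult power_minus[of "_ ^ 2"] q_eq)
    moreover have "inverse \<sigma> = \<sigma>"
      using \<sigma> by (rule inverse_unique)
    ultimately show ?thesis
      unfolding \<sigma>_def[symmetric] by (simp add: divide_inverse mult_ac flip: power_inverse)
  qed
  also have "\<i> * K $ ?n = f_amp a c ?e * C_even a c eps \<alpha> k / of_real (kappa eps * (\<alpha> - eps))"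
  proof -
    define Q where "Q s = (\<Sum>j=0..s. (-1) ^ j * pochhammer (of_nat k + 1 / 2) j / (fact j * (F $ 2) ^ j) *
         bell_ord (\<lambda>r. F $ (r + 2)) s j)" for s
    have "K $ ?n = (\<Sum>s=0..?n. G $ (?n - s) * Q s) / w ^ (?n + 1)"
      unfolding K_def Q_def
      by (rule fps_nth_compose_mult_deriv_of_square[OF F(2-4) w T01 FT])
    also have "(\<Sum>s=0..?n. G $ (?n - s) * Q s) = G $ 0 * (\<Sum>s=0..?n. G $ (?n - s) / G $ 0 * Q s)"
      using G0(2) by (simp add: sum_distrib_left)
    \<comment> \<open>Here \<open>alpha_hat eps 0\<close> = w^2, so the prefactor of
      \<open>C_even\<close> cancels all but one power of w.\<close>
    also have "(\<Sum>s=0..?n. G $ (?n - s) / G $ 0 * Q s) = (w\<^sup>2) ^ k * C_even a c eps \<alpha> k"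
      using w F(4) by (simp add: C_even_def beta_hat alpha_hat Q_def numeral_2_eq_2)
    also have "\<i> * (G $ 0 * ((w\<^sup>2) ^ k * C_even a c eps \<alpha> k) / w ^ (?n + 1)) =
      \<i> * G $ 0 / w * C_even a c eps \<alpha> k"
      using w by (simp add: power_mult)
    \<comment> \<open>Two signs cancel: i/w = -1/kappa, and g(eps) has denominator eps -
      \<alpha>.\<close>
    also have "\<i> * G $ 0 / w = f_amp a c ?e / of_real (kappa eps * (\<alpha> - eps))"
      using kappa \<alpha>(2) by (simp add: G0(1) g_def w_def field_simps)
    finally show ?thesis
      by simp
  qed
  finally show ?thesis
    by (simp add: A_def p_def)
qed

end
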